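(* Let $\alpha<0$ be real and let $n\ge N_\alpha$ be an integer. Then $s_{\alpha,n}$ is the unique solution on $(0,\omega_\alpha)$ of the equation $x=\varphi_{\alpha,n}(x)$. For every even $j$ with $4\le j\le n$, the number $z_{\alpha,n,j}$ is the unique solution on $[0,\pi]$ of the equation $x=d_{n,j}+\frac{\eta_\alpha(x)}{n}$.
   Context: For an integer $n\ge3$ and real $\alpha<0$, $L_{\alpha,n}$ is the real symmetric $n\times n$ matrix whose entries are: $(1,1)$ and $(n,n)$ entries equal to $1+\alpha$; $(1,n)$ and $(n,1)$ entries equal to $-\alpha$; $(k,k)$ entries equal to $2$ for $2\le k\le n-1$; $(k,k+1)$ and $(k+1,k)$ entries equal to $-1$ for $1\le k\le n-1$; all other entries $0$. Its eigenvalues, counted with multiplicity, are $\lambda_{\alpha,n,1}\le\dots\le\lambda_{\alpha,n,n}$. Put $\varkappa_\alpha=\frac{\alpha-1}{\alpha}>1$, $N_\alpha=\max\{3,\lfloor\varkappa_\alpha\rfloor+1\}$, $\omega_\alpha=\log(1-2\alpha)$, $d_{n,j}=\frac{(j-1)\pi}{n}$. For $n\ge N_\alpha$ one has $\lambda_{\alpha,n,1}<0$ and $\lambda_{\alpha,n,j}\in[0,4]$ for $j\ge2$. Let $g(x)=4\sin^2(x/2)$, a bijection $[0,\pi]\to[0,4]$, and let $z_{\alpha,n,j}\in[0,\pi]$ be defined by $g(z_{\alpha,n,j})=\lambda_{\alpha,n,j}$. Let $g_-(x)=2-2\cosh(x)=-4\sinh^2(x/2)$, a bijection $[0,\infty)\to(-\infty,0]$,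 and let $s_{\alpha,n}=g_-^{-1}(\lambda_{\alpha,n,1})$. The function $\eta_\alpha\colon[0,\pi]\to\mathbb{R}$ is $\eta_\alpha(x)=2\arctan\left(\varkappa_\alpha\tan\frac{x}{2}\right)-\pi$ (with $\eta_\alpha(\pi)=0$ by continuity), and $\varphi_{\alpha,n}\colon[0,\infty)\to\mathbb{R}$ is $\varphi_{\alpha,n}(x)=2\operatorname{arctanh}\left(\varkappa_\alpha^{-1}\tanh\frac{nx}{2}\right)$. *)

theory Defs
  imports Complex_Main "HOL-Library.Multiset" "Jordan_Normal_Form.Char_Poly"
begin

text \<open>Entries are written with the 1-based indices of the text, then shifted to the 0-based
  indices of \<^typ>\<open>real mat\<close>. The intended range is \<open>n \<ge> 3\<close>.\<close>

definition L_entry :: "real \<Rightarrow> nat \<Rightarrow> nat \<Rightarrow> nat \<Rightarrow> real" where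
  "L_entry \<alpha> n i k =
     (if (i = 1 \<and> k = 1) \<or> (i = n \<and> k = n) then 1 + \<alpha>
      else if (i = 1 \<and> k = n) \<or> (i = n \<and> k = 1) then - \<alpha>
      else if i = k then 2
      else if k = i + 1 \<or> i = k + 1 then -1
      else 0)"

definition L_mat :: "real \<Rightarrow> nat \<Rightarrow> real mat" where
  "L_mat \<alpha> n = mat n n (\<lambda>(i, k). L_entry \<alpha> n (i + 1) (k + 1))"

text \<open>The real roots of the characteristic polynomial with multiplicity, in increasing order.
  As \<open>L_mat \<alpha> n\<close> is real symmetric, all its \<open>n\<close> complex eigenvalues appear in the list.\<close>

definition eigenvalue_list :: "real mat \<Rightarrow> real list" where
  "eigenvalue_list A = sorted_list_of_multiset (proots (char_poly A))"

text \<open>\<open>eigval \<alpha> n j\<close> is the \<open>j\<close>-th smallest eigenvalue, for \<open>1 \<le> j \<le> n\<close>.\<close>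

definition eigval :: "real \<Rightarrow> nat \<Rightarrow> nat \<Rightarrow> real" where
  "eigval \<alpha> n j = eigenvalue_list (L_mat \<alpha> n) ! (j - 1)"

definition kappa :: "real \<Rightarrow> real" where
  "kappa \<alpha> = (\<alpha> - 1) / \<alpha>"

definition N_min :: "real \<Rightarrow> int" where
  "N_min \<alpha> = max 3 (\<lfloor>kappa \<alpha>\<rfloor> + 1)"

definition omega :: "real \<Rightarrow> real" where
  "omega \<alpha> = ln (1 - 2 * \<alpha>)"

definition d_point :: "nat \<Rightarrow> nat \<Rightarrow> real" where
  "d_point n j = (real j - 1) * pi / real n"

definition g_pos :: "real \<Rightarrow> real" where
  "g_pos x = 4 * (sin (x / 2))\<^sup>2"

definition g_neg :: "real \<Rightarrow> real" where
  "g_neg x = 2 - 2 * cosh x"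

text \<open>These inverses are meaningful only when the eigenvalue lies in the range \<open>[0, 4]\<close>,
  respectively \<open>(-\<infinity>, 0]\<close>, of the function inverted.\<close>

definition z_point :: "real \<Rightarrow> nat \<Rightarrow> nat \<Rightarrow> real" where
  "z_point \<alpha> n j = the_inv_into {0..pi} g_pos (eigval \<alpha> n j)"

definition s_point :: "real \<Rightarrow> nat \<Rightarrow> real" where
  "s_point \<alpha> n = the_inv_into {0..} g_neg (eigval \<alpha> n 1)"

text \<open>The value at \<open>pi\<close> is the continuous extension; it is given separately because
  \<open>tan (pi / 2) = 0\<close> in HOL.\<close>

definition eta :: "real \<Rightarrow> real \<Rightarrow> real" where
  "eta \<alpha> x = (if x = pi then 0 else 2 * arctan (kappa \<alpha> * tan (x / 2)) - pi)"

definition phi :: "real \<Rightarrow> nat \<Rightarrow> real \<Rightarrow> real" where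
  "phi \<alpha> n x = 2 * artanh (inverse (kappa \<alpha>) * tanh (real n * x / 2))"

end

theory Submission
  imports Defs
begin

text \<open>
  The matrix is the Laplacian of a cycle on \<open>n\<close> vertices in which the edge joining the vertices \<open>1\<close>
  and \<open>n\<close> has weight \<open>\<alpha>\<close> and every other edge has weight \<open>1\<close>. Reversing the order of the vertices
  is a symmetry, so eigenvectors may be sought among the symmetric and the antisymmetric ones.

  A symmetric eigenvector does not feel the weighted edge. Such eigenvectors are the symmetric
  eigenvectors of the path, and they give the eigenvalues \<open>g_pos (d_point n j)\<close> for odd \<open>j\<close>, among
  them \<open>0\<close> (\<open>eigenvalue_d_point\<close>). An antisymmetric eigenvector is an odd solution of the recurrence
  \<open>F (x + 1) + F (x - 1) = (2 - \<mu>) F x\<close>, sampled symmetrically about its zero. With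
  \<open>F x = sin (x \<theta>)\<close> the boundary condition becomes \<open>tan (n \<theta> / 2) = kappa \<alpha> * tan (\<theta> / 2)\<close>, which
  after taking the arctangent on the right branch is the equation \<open>\<theta> = d_point n j + eta \<alpha> \<theta> / n\<close>
  with \<open>j\<close> even (\<open>angle_equation_eigenvalue\<close>). With \<open>F x = sinh (x s)\<close> it becomes
  \<open>tanh (n s / 2) = kappa \<alpha> * tanh (s / 2)\<close>, which is \<open>s = phi \<alpha> n s\<close>
  (\<open>eigenvalue_hyperbolic\<close>, \<open>phi_fixed_point_iff\<close>).

  Both equations have solutions by the intermediate value theorem. The condition on \<open>n\<close> says
  \<open>n > kappa \<alpha>\<close>, and this is what makes \<open>tanh (n s / 2)\<close> exceed \<open>kappa \<alpha> * tanh (s / 2)\<close> for small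
  \<open>s\<close>. Since \<open>-pi < eta \<alpha> \<theta> < 0\<close> on the open interval, a solution with index \<open>j \<ge> 4\<close> lies strictly
  between the neighbouring grid points \<open>d_point n (j - 1)\<close> and \<open>d_point n j\<close>.

  Uniqueness and the numbering of the eigenvalues both come from counting (\<open>eigval_eqI\<close>). One
  hyperbolic solution, the eigenvalue \<open>0\<close>, and one angle in each interval
  \<open>(d_point n (j - 1), d_point n j]\<close> with \<open>3 \<le> j \<le> n\<close> are \<open>n\<close> eigenvalues in strictly increasing
  order, hence the whole list. As any solution of either equation may be put in its place in this
  list, the \<open>j\<close>-th eigenvalue determines the solution.
\<close>

section \<open>Sorted lists of simple real eigenvalues\<close>

lemma sorted_list_of_proots_eq:
  fixes p :: "real poly"
  assumes "p \<noteq> 0" "sorted_wrt (<) xs" "length xs = degree p"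
    and roots: "\<And>x. x \<in> set xs \<Longrightarrow> poly p x = 0"
  shows "sorted_list_of_multiset (proots p) = xs"
proof -
  have dist: "distinct xs"
    using assms(2) by (simp add: strict_sorted_iff)
  have "mset xs \<subseteq># proots p"
  proof (rule mset_subset_eqI)
    fix a
    show "count (mset xs) a \<le> count (proots p) a"
      using dist roots[of a] \<open>p \<noteq> 0\<close> order_root[of p a]
      by (auto simp: distinct_count_atmost_1)
  qed
  moreover have "size (proots p) \<le> size (mset xs)"
    using size_proots_le[of p] assms(3) by simp
  ultimately have "mset xs = proots p"
    using mset_subset_size[of "mset xs" "proots p"] by (fastforce simp: subset_mset.le_less)
  then have "sorted_list_of_multiset (proots p) = sort xs"
    using sorted_list_of_multiset_mset by metis
  then show ?thesis
    using assms(2) by (simp add: strict_sorted_imp_sorted sorted_sort_id)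
qed

lemma eigenvalue_list_eqI:
  assumes A: "A \<in> carrier_mat n n" and "sorted_wrt (<) xs" "length xs = n"
    and "\<And>x. x \<in> set xs \<Longrightarrow> eigenvalue A x"
  shows "eigenvalue_list A = xs"
proof -
  have "char_poly A \<noteq> 0"
    using degree_monic_char_poly[OF A] by force
  then show ?thesis
    unfolding eigenvalue_list_def
    using assms degree_monic_char_poly[OF A] eigenvalue_root_char_poly[OF A]
    by (intro sorted_list_of_proots_eq) auto
qed

section \<open>Eigenvectors from solutions of the three-term recurrence\<close>

lemma L_mat_carrier: "L_mat \<alpha> n \<in> carrier_mat n n"
  by (simp add: L_mat_def)

text \<open>The values \<open>f 0\<close> and \<open>f (n + 1)\<close> belong to two ghost vertices. They let the first and the last
  row of the matrix read like the interior ones; the weighted edge then only enters through the two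
  boundary conditions.\<close>

lemma eigenvalue_of_recurrence:
  fixes f :: "nat \<Rightarrow> real"
  assumes n: "3 \<le> n"
    and rec: "\<And>k. k < n \<Longrightarrow> f (k + 2) + f k = (2 - \<mu>) * f (k + 1)"
    and left: "f 0 - f 1 = \<alpha> * (f n - f 1)"
    and right: "f (n + 1) - f n = \<alpha> * (f 1 - f n)"
    and nz: "f 1 \<noteq> 0"
  shows "eigenvalue (L_mat \<alpha> n) \<mu>"
proof -
  let ?v = "vec n (\<lambda>i. f (i + 1))"
  have "L_mat \<alpha> n *\<^sub>v ?v = \<mu> \<cdot>\<^sub>v ?v"
  proof (rule eq_vecI)
    show "dim_vec (L_mat \<alpha> n *\<^sub>v ?v) = dim_vec (\<mu> \<cdot>\<^sub>v ?v)"
      by (simp add: L_mat_def)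
    fix i
    assume "i < dim_vec (\<mu> \<cdot>\<^sub>v ?v)"
    then have i: "i < n" by simp
    have "(L_mat \<alpha> n *\<^sub>v ?v) $ i = (\<Sum>k = 0..<n. L_entry \<alpha> n (i + 1) (k + 1) * f (k + 1))"
      using i by (auto simp: L_mat_def scalar_prod_def)
    also have "\<dots> = \<mu> * f (i + 1)"
    proof -
      consider "i = 0" | "i = n - 1" | "0 < i" "i < n - 1"
        using i by linarith
      then show ?thesis
      proof cases
        case 1
        have "(\<Sum>k = 0..<n. L_entry \<alpha> n (i + 1) (k + 1) * f (k + 1))
            = (\<Sum>k \<in> {0, 1, n - 1}. L_entry \<alpha> n (i + 1) (k + 1) * f (k + 1))"
          using 1 n by (intro sum.mono_neutral_right) (auto simp: L_entry_def)
        then show ?thesis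
          using 1 n rec[of 0] left by (simp add: L_entry_def algebra_simps numeral_2_eq_2)
      next
        case 2
        have "(\<Sum>k = 0..<n. L_entry \<alpha> n (i + 1) (k + 1) * f (k + 1))
            = (\<Sum>k \<in> {0, n - 2, n - 1}. L_entry \<alpha> n (i + 1) (k + 1) * f (k + 1))"
          using 2 n by (intro sum.mono_neutral_right) (auto simp: L_entry_def)
        moreover obtain m where "n = m + 3"
          using n by (metis add.commute le_Suc_ex)
        ultimately show ?thesis
          using 2 rec[of "n - 1"] right by (simp add: L_entry_def algebra_simps eval_nat_numeral)
      next
        case 3
        have "(\<Sum>k = 0..<n. L_entry \<alpha> n (i + 1) (k + 1) * f (k + 1))
            = (\<Sum>k \<in> {i - 1, i, i + 1}. L_entry \<alpha> n (i + 1) (k + 1) * f (k + 1))"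
          using 3 n by (intro sum.mono_neutral_right) (auto simp: L_entry_def)
        moreover obtain m where "i = m + 1"
          using 3 by (metis Suc_eq_plus1 gr0_implies_Suc)
        ultimately show ?thesis
          using 3 n rec[of i] by (simp add: L_entry_def algebra_simps)
      qed
    qed
    finally show "(L_mat \<alpha> n *\<^sub>v ?v) $ i = (\<mu> \<cdot>\<^sub>v ?v) $ i"
      using i by simp
  qed
  moreover have "?v \<noteq> 0\<^sub>v n"
  proof
    assume "?v = 0\<^sub>v n"
    then have "?v $ 0 = 0\<^sub>v n $ 0" by simp
    then show False using n nz by simp
  qed
  ultimately show ?thesis
    unfolding eigenvalue_def eigenvector_def using L_mat_carrier[of \<alpha> n]
    by (intro exI[of _ ?v]) (auto simp: L_mat_def)
qed

text \<open>Vertex \<open>k\<close> is placed at \<open>k - (n + 1) / 2\<close>, so that the reversal of the vertices becomes the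
  reflection at \<open>0\<close> and oddness turns the two boundary conditions into a single one, at the last
  vertex \<open>(n - 1) / 2\<close> and its ghost neighbour \<open>(n + 1) / 2\<close>.\<close>

lemma eigenvalue_of_odd_function:
  fixes F :: "real \<Rightarrow> real"
  assumes n: "3 \<le> n"
    and odd: "\<And>x. F (- x) = - F x"
    and rec: "\<And>x. F (x + 1) + F (x - 1) = (2 - \<mu>) * F x"
    and bd: "F ((real n + 1) / 2) = (1 - 2 * \<alpha>) * F ((real n - 1) / 2)"
    and nz: "F ((real n - 1) / 2) \<noteq> 0"
  shows "eigenvalue (L_mat \<alpha> n) \<mu>"
proof -
  define f where "f k = F (real k - (real n + 1) / 2)" for k
  have "0 - (real n + 1) / 2 = - ((real n + 1) / 2)" "1 - (real n + 1) / 2 = - ((real n - 1) / 2)"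
    by (simp_all add: field_simps)
  then have f0: "f 0 = - F ((real n + 1) / 2)" and f1: "f 1 = - F ((real n - 1) / 2)"
    using odd by (simp_all add: f_def)
  have fn: "f n = F ((real n - 1) / 2)" and fn1: "f (n + 1) = F ((real n + 1) / 2)"
    by (auto simp: f_def field_simps)
  show ?thesis
  proof (rule eigenvalue_of_recurrence[OF n, of f])
    fix k
    show "f (k + 2) + f k = (2 - \<mu>) * f (k + 1)"
      using rec[of "real k + 1 - (real n + 1) / 2"] by (simp add: f_def algebra_simps)
  qed (use bd nz in \<open>simp_all only: f0 f1 fn fn1\<close>, simp_all add: algebra_simps)
qed

lemma g_pos_eq: "g_pos x = 2 - 2 * cos x"
  using cos_double_sin[of "x / 2"] by (simp add: g_pos_def)

text \<open>The eigenvector has entries \<open>cos ((k - 1 / 2) * \<theta>)\<close>. As a function of \<open>k\<close> this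
  is even about \<open>1 / 2\<close>, and it has period \<open>n\<close> because \<open>n \<theta>\<close> is a multiple of \<open>2 pi\<close>. Hence its
  values at \<open>0\<close>, \<open>1\<close>, \<open>n\<close> and \<open>n + 1\<close> agree, and both boundary conditions read \<open>0 = 0\<close> whatever \<open>\<alpha>\<close> is.\<close>

lemma eigenvalue_symmetric:
  assumes n: "3 \<le> n" and \<theta>: "0 \<le> \<theta>" "\<theta> < pi" "real n * \<theta> = 2 * real m * pi"
  shows "eigenvalue (L_mat \<alpha> n) (g_pos \<theta>)"
proof -
  define f where "f k = cos ((real k - 1 / 2) * \<theta>)" for k :: nat
  have per: "cos (real n * \<theta> + x) = cos x" for x
    unfolding \<theta>(3) by (simp add: cos_add)
  have f0: "f 0 = cos (\<theta> / 2)" and f1: "f 1 = cos (\<theta> / 2)"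
    by (auto simp: f_def)
  have fn: "f n = cos (\<theta> / 2)"
    using per[of "- (\<theta> / 2)"] by (simp add: f_def algebra_simps)
  have fn1: "f (n + 1) = cos (\<theta> / 2)"
    using per[of "\<theta> / 2"] by (simp add: f_def algebra_simps)
  show ?thesis
  proof (rule eigenvalue_of_recurrence[OF n, of f])
    fix k
    show "f (k + 2) + f k = (2 - g_pos \<theta>) * f (k + 1)"
      using cos_add[of "(real k + 1 / 2) * \<theta>" \<theta>] cos_diff[of "(real k + 1 / 2) * \<theta>" \<theta>]
      by (simp add: f_def g_pos_eq algebra_simps)
    show "f 1 \<noteq> 0"
      using \<theta> cos_gt_zero_pi[of "\<theta> / 2"] unfolding f1 by simp
  qed (simp_all add: f0 f1 fn fn1 del: One_nat_def add_Suc_right)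
qed

text \<open>The boundary condition for \<open>sin (x \<theta>)\<close> is \<open>sin (a + b) = (1 - 2 * \<alpha>) * sin (a - b)\<close> with
  \<open>a = n \<theta> / 2\<close> and \<open>b = \<theta> / 2\<close>. By the addition theorems it says
  \<open>\<alpha> * sin a * cos b = (\<alpha> - 1) * cos a * sin b\<close>, which is the tangent equation with its denominators
  cleared.\<close>

lemma eigenvalue_antisymmetric:
  assumes \<alpha>: "\<alpha> < 0" and n: "3 \<le> n" and \<theta>: "0 < \<theta>" "\<theta> < pi"
    and c: "cos (real n * \<theta> / 2) \<noteq> 0"
    and t: "tan (real n * \<theta> / 2) = kappa \<alpha> * tan (\<theta> / 2)"
  shows "eigenvalue (L_mat \<alpha> n) (g_pos \<theta>)"
proof -
  define a b where "a = real n * \<theta> / 2" and "b = \<theta> / 2"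
  have cb: "cos b \<noteq> 0" and sb: "sin b \<noteq> 0"
    using \<theta> cos_gt_zero_pi[of b] sin_gt_zero[of b] by (auto simp: b_def)
  have eq: "\<alpha> * (sin a * cos b) = (\<alpha> - 1) * (cos a * sin b)"
    using t c cb \<alpha> unfolding a_def[symmetric] b_def[symmetric]
    by (simp add: tan_def kappa_def field_simps)
  have plus: "(real n + 1) / 2 * \<theta> = a + b" and minus: "(real n - 1) / 2 * \<theta> = a - b"
    by (auto simp: a_def b_def field_simps)
  have bd: "sin (a + b) = (1 - 2 * \<alpha>) * sin (a - b)"
    using eq by (simp add: sin_add sin_diff algebra_simps)
  have nz: "sin (a - b) \<noteq> 0"
  proof
    assume 0: "sin (a - b) = 0"
    with bd have "sin (a + b) = 0" by simp
    with 0 have "cos a * sin b = 0" by (simp add: sin_add sin_diff)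
    with c sb show False by (simp add: a_def)
  qed
  show ?thesis
  proof (rule eigenvalue_of_odd_function[OF n, of "\<lambda>x. sin (x * \<theta>)"])
    fix x
    show "sin ((x + 1) * \<theta>) + sin ((x - 1) * \<theta>) = (2 - g_pos \<theta>) * sin (x * \<theta>)"
      by (simp add: g_pos_eq sin_add sin_diff algebra_simps)
  qed (use bd nz in \<open>simp_all only: plus minus\<close>, simp_all)
qed

text \<open>This is the preceding computation for an imaginary angle.\<close>

lemma eigenvalue_hyperbolic:
  assumes \<alpha>: "\<alpha> < 0" and n: "3 \<le> n" and s: "0 < s"
    and t: "tanh (real n * s / 2) = kappa \<alpha> * tanh (s / 2)"
  shows "eigenvalue (L_mat \<alpha> n) (g_neg s)"
proof -
  define a b where "a = real n * s / 2" and "b = s / 2"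
  have eq: "\<alpha> * (sinh a * cosh b) = (\<alpha> - 1) * (cosh a * sinh b)"
    using t \<alpha> unfolding a_def[symmetric] b_def[symmetric]
    by (simp add: tanh_def kappa_def field_simps)
  have plus: "(real n + 1) / 2 * s = a + b" and minus: "(real n - 1) / 2 * s = a - b"
    by (auto simp: a_def b_def field_simps)
  have bd: "sinh (a + b) = (1 - 2 * \<alpha>) * sinh (a - b)"
    using eq by (simp add: sinh_add sinh_diff algebra_simps)
  have "(real n - 1) / 2 * s \<noteq> 0"
    using n s by simp
  then have nz: "sinh (a - b) \<noteq> 0"
    unfolding minus by simp
  show ?thesis
  proof (rule eigenvalue_of_odd_function[OF n, of "\<lambda>x. sinh (x * s)"])
    fix x
    show "sinh ((x + 1) * s) + sinh ((x - 1) * s) = (2 - g_neg s) * sinh (x * s)"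
      by (simp add: g_neg_def sinh_add sinh_diff algebra_simps)
  qed (use bd nz in \<open>simp_all only: plus minus\<close>, simp_all)
qed

section \<open>The hyperbolic equation\<close>

lemma kappa_gt_1: "\<alpha> < 0 \<Longrightarrow> 1 < kappa \<alpha>"
  by (simp add: kappa_def field_simps)

lemma tanh_artanh_real:
  fixes y :: real
  assumes "- 1 < y" "y < 1"
  shows "tanh (artanh y) = y"
proof -
  have "exp (- 2 * artanh y) = (1 - y) / (1 + y)"
    using assms by (simp add: artanh_def exp_minus)
  then have "tanh (artanh y) = (1 - (1 - y) / (1 + y)) / (1 + (1 - y) / (1 + y))"
    by (simp only: tanh_real_altdef)
  also have "\<dots> = y"
    using assms by (simp add: divide_simps)
  finally show ?thesis .
qed

text \<open>Since \<open>kappa \<alpha> > 1\<close>, the argument of \<open>artanh\<close> stays in the interval where \<open>artanh\<close> inverts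
  \<open>tanh\<close>.\<close>

lemma phi_fixed_point_iff:
  assumes "\<alpha> < 0"
  shows "x = phi \<alpha> n x \<longleftrightarrow> tanh (real n * x / 2) = kappa \<alpha> * tanh (x / 2)"
proof -
  let ?y = "inverse (kappa \<alpha>) * tanh (real n * x / 2)"
  have k: "1 < kappa \<alpha>" using assms by (rule kappa_gt_1)
  have "- 1 < ?y" "?y < 1"
    using k tanh_real_lt_1[of "real n * x / 2"] tanh_real_gt_neg1[of "real n * x / 2"]
    by (simp_all add: field_simps)
  then have "tanh (phi \<alpha> n x / 2) = ?y"
    by (simp add: phi_def tanh_artanh_real)
  then have "x = phi \<alpha> n x \<longleftrightarrow> tanh (x / 2) = ?y"
    by (metis artanh_tanh_real field_sum_of_halves phi_def mult_2)
  then show ?thesis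
    using k by (auto simp: field_simps)
qed

text \<open>The difference \<open>h\<close> of the two sides vanishes at \<open>0\<close> with slope \<open>(n - kappa \<alpha>) / 2 > 0\<close>, so it is
  positive just to the right of \<open>0\<close>. It is negative at \<open>omega \<alpha>\<close>, because \<open>omega \<alpha>\<close> is exactly the
  point where \<open>kappa \<alpha> * tanh (x / 2)\<close> reaches \<open>1\<close>.\<close>

lemma hyperbolic_solution_exists:
  assumes \<alpha>: "\<alpha> < 0" and n: "kappa \<alpha> < real n"
  shows "\<exists>x \<in> {0<..<omega \<alpha>}. tanh (real n * x / 2) = kappa \<alpha> * tanh (x / 2)"
proof -
  define h where "h x = tanh (real n * x / 2) - kappa \<alpha> * tanh (x / 2)" for x
  have \<omega>: "0 < omega \<alpha>"
    using \<alpha> by (simp add: omega_def)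
  have "(h has_real_derivative (real n - kappa \<alpha>) / 2) (at 0)"
    unfolding h_def by (auto intro!: derivative_eq_intros simp: field_simps)
  then obtain d where d: "0 < d" "\<And>t. 0 < t \<Longrightarrow> t < d \<Longrightarrow> h 0 < h (0 + t)"
    using DERIV_pos_inc_right[of h "(real n - kappa \<alpha>) / 2" 0] n by auto
  define a where "a = min (d / 2) (omega \<alpha> / 2)"
  have a: "0 < a" "a < omega \<alpha>" "0 < h a"
    using d(1) d(2)[of a] \<omega> by (auto simp: a_def h_def)
  have "tanh (omega \<alpha> / 2) = inverse (kappa \<alpha>)"
  proof -
    have "exp (- 2 * (omega \<alpha> / 2)) = 1 / (1 - 2 * \<alpha>)"
      using \<alpha> by (simp add: omega_def exp_minus inverse_eq_divide)
    then have "tanh (omega \<alpha> / 2) = (1 - 1 / (1 - 2 * \<alpha>)) / (1 + 1 / (1 - 2 * \<alpha>))"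
      by (simp only: tanh_real_altdef)
    also have "\<dots> = (- 2 * \<alpha>) / (2 - 2 * \<alpha>)"
      using \<alpha> by (simp add: add_divide_eq_iff diff_divide_eq_iff)
    also have "\<dots> = inverse (kappa \<alpha>)"
      using \<alpha> by (simp add: kappa_def field_simps)
    finally show ?thesis .
  qed
  then have b: "h (omega \<alpha>) < 0"
    using kappa_gt_1[OF \<alpha>] tanh_real_lt_1 by (simp add: h_def)
  have "continuous_on {a..omega \<alpha>} h"
    unfolding h_def by (intro continuous_intros) auto
  then obtain x where x: "a \<le> x" "x \<le> omega \<alpha>" "h x = 0"
    using IVT2'[of h "omega \<alpha>" 0 a] a b by auto
  moreover have "x \<noteq> omega \<alpha>" using x b by auto
  ultimately show ?thesis
    using a by (intro bexI[of _ x]) (auto simp: h_def)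
qed

section \<open>The angle equation\<close>

lemma eta_bounds:
  assumes "\<alpha> < 0" "0 < x" "x < pi"
  shows "- pi < eta \<alpha> x" "eta \<alpha> x < 0"
proof -
  have "0 < kappa \<alpha> * tan (x / 2)"
    using assms kappa_gt_1[of \<alpha>] tan_gt_zero[of "x / 2"] by simp
  then show "- pi < eta \<alpha> x" "eta \<alpha> x < 0"
    using assms arctan_ubound[of "kappa \<alpha> * tan (x / 2)"] by (auto simp: eta_def)
qed

lemma d_point_less_pi: "j \<le> n \<Longrightarrow> d_point n j < pi"
  by (cases "n = 0") (simp_all add: d_point_def divide_less_eq mult.commute)

lemma d_point_diff: "0 < j \<Longrightarrow> 0 < n \<Longrightarrow> d_point n (j - Suc 0) = d_point n j - pi / real n"
  by (simp add: d_point_def field_simps of_nat_diff)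

lemma d_point_pos: "2 \<le> j \<Longrightarrow> 0 < n \<Longrightarrow> 0 < d_point n j"
  by (simp add: d_point_def)

text \<open>On the open interval the bounds on \<open>eta\<close> put \<open>x\<close> less than one grid step below \<open>d_point n j\<close>. The
  endpoints are excluded separately: at \<open>0\<close> the right-hand side is \<open>d_point n (j - 1) > 0\<close>, and at
  \<open>pi\<close> it is \<open>d_point n j < pi\<close>.\<close>

lemma angle_equation_location:
  assumes \<alpha>: "\<alpha> < 0" and n: "3 \<le> n" and j: "4 \<le> j" "j \<le> n"
    and x: "x \<in> {0..pi}" and eq: "x = d_point n j + eta \<alpha> x / real n"
  shows "d_point n (j - 1) < x" "x < d_point n j"
proof -
  have "x \<noteq> 0"
  proof
    assume 0: "x = 0"
    then have "d_point n (j - 1) = 0"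
      using eq n j by (simp add: d_point_diff eta_def)
    moreover have "0 < d_point n (j - 1)"
      using j n by (intro d_point_pos) auto
    ultimately show False by simp
  qed
  moreover have "x \<noteq> pi"
    using eq d_point_less_pi[OF j(2)] by (auto simp: eta_def)
  ultimately have "- pi < eta \<alpha> x" "eta \<alpha> x < 0"
    using eta_bounds[OF \<alpha>, of x] x by auto
  then have "- (pi / real n) < eta \<alpha> x / real n" "eta \<alpha> x / real n < 0"
    using n by (simp_all add: field_simps)
  then show "d_point n (j - 1) < x" "x < d_point n j"
    using eq n j by (simp_all add: d_point_diff)
qed

text \<open>Multiplied by \<open>n / 2\<close>, the equation says that \<open>n x / 2\<close> is \<open>arctan (kappa \<alpha> * tan (x / 2))\<close> shifted
  by \<open>(j - 2) / 2\<close> half-turns \<open>pi\<close>. For even \<open>j\<close> this is a whole number of periods of the tangent.\<close>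

lemma angle_equation_eigenvalue:
  assumes \<alpha>: "\<alpha> < 0" and n: "3 \<le> n" and j: "4 \<le> j" "j \<le> n" "even j"
    and x: "x \<in> {0..pi}" and eq: "x = d_point n j + eta \<alpha> x / real n"
  shows "eigenvalue (L_mat \<alpha> n) (g_pos x)"
proof -
  note loc = angle_equation_location[OF \<alpha> n j(1,2) x eq]
  have "0 < d_point n (j - 1)"
    using j n by (intro d_point_pos) auto
  then have x': "0 < x" "x < pi"
    using loc d_point_less_pi[OF j(2)] by linarith+
  obtain m where m: "j = 2 * m + 2"
  proof -
    obtain q where "j = 2 * q" using j(3) by (rule evenE)
    then show ?thesis using j(1) by (intro that[of "q - 1"]) simp
  qed
  let ?A = "arctan (kappa \<alpha> * tan (x / 2))"
  have "real n * x = (real j - 1) * pi + eta \<alpha> x"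
    using n by (subst eq) (simp add: d_point_def field_simps)
  then have A: "real n * x / 2 = ?A + real m * pi"
    using x' m by (simp add: eta_def algebra_simps add_divide_distrib)
  show ?thesis
  proof (rule eigenvalue_antisymmetric[OF \<alpha> n x'])
    show "tan (real n * x / 2) = kappa \<alpha> * tan (x / 2)"
      unfolding A by (simp add: tan_periodic_nat tan_arctan)
    show "cos (real n * x / 2) \<noteq> 0"
      unfolding A by (simp add: cos_add)
  qed
qed

text \<open>The sign change is located between the grid points \<open>d_point n (j - 1)\<close> and \<open>d_point n j\<close>. Both lie
  in the open interval from \<open>0\<close> to \<open>pi\<close>, where \<open>eta\<close> is given by the arctangent formula and
  is therefore continuous.\<close>

lemma angle_equation_solvable:
  assumes \<alpha>: "\<alpha> < 0" and n: "3 \<le> n" and j: "4 \<le> j" "j \<le> n"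
  shows "\<exists>x \<in> {0..pi}. x = d_point n j + eta \<alpha> x / real n"
proof -
  \<comment> \<open>The formula defining \<open>eta\<close> below \<open>pi\<close>, without the case distinction, so that continuity is
    syntactic.\<close>
  define F where "F x = x - d_point n j - (2 * arctan (kappa \<alpha> * tan (x / 2)) - pi) / real n" for x
  let ?a = "d_point n (j - 1)" and ?b = "d_point n j"
  have lt: "?a < ?b" using n j by (simp add: d_point_diff)
  have a: "0 < ?a" using d_point_pos[of "j - 1" n] j n by simp
  have b: "?b < pi" using d_point_less_pi[OF j(2)] .
  have F: "F x = x - ?b - eta \<alpha> x / real n" if "x < pi" for x
    using that by (simp add: F_def eta_def)
  have "F ?a = - (pi + eta \<alpha> ?a) / real n"
    using a b lt n j by (simp add: F) (simp add: d_point_diff field_simps)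
  then have "F ?a \<le> 0"
    using eta_bounds[OF \<alpha> a] lt b by (simp add: divide_nonpos_nonneg)
  moreover have "0 \<le> F ?b"
    using eta_bounds[OF \<alpha>, of ?b] a b lt by (simp add: F divide_nonpos_nonneg)
  moreover have "continuous_on {?a..?b} F"
  proof -
    have "cos (x / 2) \<noteq> 0" if "x \<in> {?a..?b}" for x
      using that a b cos_gt_zero_pi[of "x / 2"] by simp
    then show ?thesis unfolding F_def by (intro continuous_intros) (use n in auto)
  qed
  ultimately obtain x where x: "?a \<le> x" "x \<le> ?b" "F x = 0"
    using IVT'[of F ?a 0 ?b] lt by auto
  then show ?thesis
    using a b F[of x] by (intro bexI[of _ x]) auto
qed

section \<open>Numbering the eigenvalues\<close>

lemma eigenvalue_d_point:
  assumes n: "3 \<le> n" and j: "odd j" "j \<le> n"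
  shows "eigenvalue (L_mat \<alpha> n) (g_pos (d_point n j))"
proof -
  obtain m where m: "j = 2 * m + 1" using j by (auto elim: oddE)
  show ?thesis
    using n m d_point_less_pi[OF j(2)]
    by (intro eigenvalue_symmetric[where m = m]) (auto simp: d_point_def)
qed

lemma g_pos_less: "0 \<le> x \<Longrightarrow> x < y \<Longrightarrow> y \<le> pi \<Longrightarrow> g_pos x < g_pos y"
  by (simp add: g_pos_eq cos_monotone_0_pi)

lemma the_inv_g_pos: "x \<in> {0..pi} \<Longrightarrow> the_inv_into {0..pi} g_pos (g_pos x) = x"
  by (rule the_inv_into_f_f) (auto simp: g_pos_eq inj_on_def cos_inj_pi)

lemma the_inv_g_neg: "0 \<le> x \<Longrightarrow> the_inv_into {0..} g_neg (g_neg x) = x"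
proof (rule the_inv_into_f_f)
  have "x = y" if "0 \<le> x" "0 \<le> y" "cosh x = cosh y" for x y :: real
    using that cosh_real_strict_mono[of x y] cosh_real_strict_mono[of y x]
    by (cases x y rule: linorder_cases) auto
  then show "inj_on g_neg {0..}"
    by (auto simp: g_neg_def inj_on_def)
qed simp

text \<open>The angles \<open>\<theta> 3, \<dots>, \<theta> n\<close> are separated by grid points and lie in \<open>(0, pi)\<close>, where \<open>g_pos\<close> is
  strictly increasing. Together with the negative eigenvalue \<open>g_neg s\<close> and the eigenvalue \<open>0\<close> of the
  constant vector they are \<open>n\<close> eigenvalues in increasing order, so they exhaust the spectrum. The
  freedom in choosing \<open>s\<close> and \<open>\<theta>\<close> is what later yields uniqueness: every admissible choice produces
  the same list of eigenvalues.\<close>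

lemma eigval_eqI:
  assumes n: "3 \<le> n"
    and s: "0 < s" "eigenvalue (L_mat \<alpha> n) (g_neg s)"
    and \<theta>: "\<And>i. 3 \<le> i \<Longrightarrow> i \<le> n \<Longrightarrow>
      d_point n (i - 1) < \<theta> i \<and> \<theta> i \<le> d_point n i \<and> eigenvalue (L_mat \<alpha> n) (g_pos (\<theta> i))"
  shows "eigval \<alpha> n 1 = g_neg s"
    and "3 \<le> j \<Longrightarrow> j \<le> n \<Longrightarrow> eigval \<alpha> n j = g_pos (\<theta> j)"
proof -
  \<comment> \<open>Indexed from \<open>0\<close> like the list: \<open>\<mu> i\<close> is the eigenvalue with number \<open>i + 1\<close>.\<close>
  define \<mu> where "\<mu> i = (if i = 0 then g_neg s else if i = 1 then 0 else g_pos (\<theta> (i + 1)))" for i :: nat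
  have "g_neg s < 0"
    using s cosh_real_strict_mono[of 0 s] by (simp add: g_neg_def)
  have \<theta>_pos: "0 < \<theta> i" if "3 \<le> i" "i \<le> n" for i
  proof -
    have "0 < d_point n (i - 1)"
      using that by (intro d_point_pos) auto
    then show ?thesis using \<theta>[OF that] by linarith
  qed
  have \<theta>_pi: "\<theta> i < pi" if "3 \<le> i" "i \<le> n" for i
    using \<theta>[OF that] that d_point_less_pi[of i n] by simp
  have step: "\<mu> i < \<mu> (Suc i)" if "Suc i < n" for i
  proof -
    consider "i = 0" | "i = 1" | "2 \<le> i" by linarith
    then show ?thesis
    proof cases
      case 1
      then show ?thesis using \<open>g_neg s < 0\<close> by (simp add: \<mu>_def)
    next
      case 2
      then show ?thesis
        using n g_pos_less[of 0 "\<theta> 3"] \<theta>_pos[of 3] \<theta>_pi[of 3]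
        by (simp add: \<mu>_def g_pos_def eval_nat_numeral)
    next
      case 3
      then have "\<theta> (i + 1) < \<theta> (i + 2)"
        using \<theta>[of "i + 1"] \<theta>[of "i + 2"] that by simp
      then show ?thesis
        using 3 that \<theta>_pos[of "i + 1"] \<theta>_pi[of "i + 2"] by (auto simp: \<mu>_def intro!: g_pos_less)
    qed
  qed
  have mono: "\<mu> i < \<mu> k" if "i < k" "k < n" for i k
    using that
  proof (induction k)
    case (Suc k)
    then show ?case
      using step[of k] by (cases "i = k") (auto intro: less_trans)
  qed simp
  have "eigenvalue (L_mat \<alpha> n) (\<mu> i)" if "i < n" for i
  proof -
    have "eigenvalue (L_mat \<alpha> n) 0"
      using eigenvalue_d_point[OF n, of 1 \<alpha>] n by (simp add: d_point_def g_pos_def)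
    then show ?thesis
      using s \<theta>[of "i + 1"] that by (auto simp: \<mu>_def)
  qed
  then have "eigenvalue_list (L_mat \<alpha> n) = map \<mu> [0..<n]"
    using mono
    by (intro eigenvalue_list_eqI[OF L_mat_carrier]) (auto simp: sorted_wrt_iff_nth_less)
  then have ev: "eigval \<alpha> n i = \<mu> (i - 1)" if "1 \<le> i" "i \<le> n" for i
    using that by (simp add: eigval_def)
  show "eigval \<alpha> n 1 = g_neg s"
    using n by (subst ev) (auto simp: \<mu>_def)
  show "eigval \<alpha> n j = g_pos (\<theta> j)" if "3 \<le> j" "j \<le> n"
    using that by (subst ev) (auto simp: \<mu>_def)
qed

lemma spectral_angles_exist:
  assumes \<alpha>: "\<alpha> < 0" and n: "3 \<le> n"
  shows "\<exists>\<theta>. \<forall>i. 3 \<le> i \<longrightarrow> i \<le> n \<longrightarrow>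
    d_point n (i - 1) < \<theta> i \<and> \<theta> i \<le> d_point n i \<and> eigenvalue (L_mat \<alpha> n) (g_pos (\<theta> i))"
proof -
  have "\<exists>t. d_point n (i - 1) < t \<and> t \<le> d_point n i \<and> eigenvalue (L_mat \<alpha> n) (g_pos t)"
    if i: "3 \<le> i" "i \<le> n" for i
  proof (cases "even i")
    case True
    then have i4: "4 \<le> i" using i by (cases "i = 3") auto
    then obtain t where t: "t \<in> {0..pi}" "t = d_point n i + eta \<alpha> t / real n"
      using angle_equation_solvable[OF \<alpha> n _ i(2)] by blast
    show ?thesis
      using angle_equation_location[OF \<alpha> n i4 i(2) t] angle_equation_eigenvalue[OF \<alpha> n i4 i(2) True t]
      by (intro exI[of _ t]) simp
  next
    case False
    then show ?thesis
      using eigenvalue_d_point[OF n False i(2), of \<alpha>] i n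
      by (intro exI[of _ "d_point n i"]) (simp add: d_point_diff)
  qed
  then show ?thesis by metis
qed

theorem theorem2p2:
  fixes \<alpha> :: real and n :: nat
  assumes "\<alpha> < 0" and "int n \<ge> N_min \<alpha>"
  shows "(s_point \<alpha> n \<in> {0<..<omega \<alpha>} \<and> s_point \<alpha> n = phi \<alpha> n (s_point \<alpha> n) \<and>
          (\<forall>x \<in> {0<..<omega \<alpha>}. x = phi \<alpha> n x \<longrightarrow> x = s_point \<alpha> n)) \<and>
         (\<forall>j. even j \<and> 4 \<le> j \<and> j \<le> n \<longrightarrow>
            z_point \<alpha> n j \<in> {0..pi} \<and>
            z_point \<alpha> n j = d_point n j + eta \<alpha> (z_point \<alpha> n j) / real n \<and>
            (\<forall>x \<in> {0..pi}. x = d_point n j + eta \<alpha> x / real n \<longrightarrow> x = z_point \<alpha> n j))"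
proof -
  note \<alpha> = \<open>\<alpha> < 0\<close>
  have n: "3 \<le> n"
    using assms(2) by (simp add: N_min_def)
  have "\<lfloor>kappa \<alpha>\<rfloor> < int n"
    using assms(2) by (simp add: N_min_def)
  then have k: "kappa \<alpha> < real n"
    by (simp add: floor_less_iff)
  obtain s where s: "s \<in> {0<..<omega \<alpha>}" "s = phi \<alpha> n s"
    using hyperbolic_solution_exists[OF \<alpha> k] by (auto simp: phi_fixed_point_iff[OF \<alpha>])
  obtain \<theta> where \<theta>: "\<And>i. 3 \<le> i \<Longrightarrow> i \<le> n \<Longrightarrow>
      d_point n (i - 1) < \<theta> i \<and> \<theta> i \<le> d_point n i \<and> eigenvalue (L_mat \<alpha> n) (g_pos (\<theta> i))"
    using spectral_angles_exist[OF \<alpha> n] by blast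
  have hyp: "eigenvalue (L_mat \<alpha> n) (g_neg x)" if "x \<in> {0<..<omega \<alpha>}" "x = phi \<alpha> n x" for x
    using that eigenvalue_hyperbolic[OF \<alpha> n] by (simp add: phi_fixed_point_iff[OF \<alpha>])
  have s_point: "s_point \<alpha> n = x" if "x \<in> {0<..<omega \<alpha>}" "x = phi \<alpha> n x" for x
    using eigval_eqI(1)[OF n _ hyp[OF that] \<theta>] that(1) by (simp add: s_point_def the_inv_g_neg)
  have z_point: "z_point \<alpha> n j = x"
    if j: "even j" "4 \<le> j" "j \<le> n"
      and x: "x \<in> {0..pi}" "x = d_point n j + eta \<alpha> x / real n" for j x
  proof -
    \<comment> \<open>Any solution \<open>x\<close> may replace the angle chosen in the \<open>j\<close>-th interval.\<close>
    have "d_point n (i - 1) < (\<theta>(j := x)) i \<and> (\<theta>(j := x)) i \<le> d_point n i \<and>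
        eigenvalue (L_mat \<alpha> n) (g_pos ((\<theta>(j := x)) i))" if "3 \<le> i" "i \<le> n" for i
      using \<theta>[OF that] angle_equation_location[OF \<alpha> n j(2,3) x]
        angle_equation_eigenvalue[OF \<alpha> n j(2,3,1) x] by simp
    from eigval_eqI(2)[OF n _ hyp[OF s] this, of j] have "eigval \<alpha> n j = g_pos x"
      using s(1) j by simp
    then show ?thesis
      using x(1) by (simp add: z_point_def the_inv_g_pos)
  qed
  have "z_point \<alpha> n j \<in> {0..pi} \<and> z_point \<alpha> n j = d_point n j + eta \<alpha> (z_point \<alpha> n j) / real n"
    if j: "even j" "4 \<le> j" "j \<le> n" for j
  proof -
    obtain x where "x \<in> {0..pi}" "x = d_point n j + eta \<alpha> x / real n"
      using angle_equation_solvable[OF \<alpha> n j(2,3)] by blast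
    then show ?thesis using z_point[OF j] by metis
  qed
  then show ?thesis
    using s s_point z_point by metis
qed

end
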